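(* Let $e\geq 2$ be an integer, let $p$ be a positive integer dividing $e$ and set $e':=\frac ep$. Let $\alpha\in Q^{0}$. There exists a partition $\lambda$ with $\alpha(\lambda)=\alpha$ and $\sigma\lambda=\lambda$ if and only if $\sigma\cdot\alpha=\alpha$ and $p\mid\mathsf{w}(\alpha)$.
   Context: A partition is a finite non-increasing sequence $\lambda=(\lambda_1\ge\dots\ge\lambda_h>0)$ of positive integers (possibly empty), with nodes the pairs $(a,b)$, $1\le a\le h$, $1\le b\le\lambda_a$. The residue of $(a,b)$ is $b-a \bmod e$, and $c_i(\lambda)$ is the number of nodes of residue $i\in\mathbb{Z}/e\mathbb{Z}$. $Q=\bigoplus_{i\in\mathbb{Z}/e\mathbb{Z}}\mathbb{Z}\alpha_i$ is free abelian with basis $(\alpha_i)$, $\alpha(\lambda):=\sum_i c_i(\lambda)\alpha_i\in Q$, and $Q^{0}:=\{\alpha(\lambda):\lambda\text{ a partition}\}$. For $\alpha=\sum_ic_i\alpha_i\in Q$, its weight is $\mathsf{w}(\alpha):=c_0-\frac12\sum_{i\in\mathbb{Z}/e\mathbb{Z}}(c_i-c_{i+1})^2\in\mathbb{Z}$. The map $\sigma:Q\to Q$, $\alpha\mapsto\sigma\cdot\alpha$, is the $\mathbb{Z}$-linear map with $\sigma\cdot\alpha_i:=\alpha_{i-e'}$ for all $i\in\mathbb{Z}/e\mathbb{Z}$. Shift of partitions. The beta-set of $\lambda$ is $\beta(\lambda)=\{\lambda_a-a: a\ge1\}\subseteq\mathbb{Z}$, with $\lambda_a:=0$ for $a>h$.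 Its $e$-abacus has runners $R_i(\lambda):=\{j\in\mathbb{Z}: i+je\in\beta(\lambda)\}$ for $i\in\{0,\dots,e-1\}$. The partition $\sigma\lambda$ is the unique partition with $R_i(\sigma\lambda)=R_{(i+e')\bmod e}(\lambda)$ for all $i\in\{0,\dots,e-1\}$. *)

theory Defs
  imports Complex_Main "HOL-Library.Poly_Mapping"
begin

section \<open>Partitions and residue contents\<close>

definition is_partition :: "nat list \<Rightarrow> bool" where
  "is_partition la \<longleftrightarrow> sorted_wrt (\<ge>) la \<and> (\<forall>x\<in>set la. 0 < x)"

(* 1-based, and padded with zeros beyond the length *)
definition part :: "nat list \<Rightarrow> nat \<Rightarrow> nat" where
  "part la a = (if 1 \<le> a \<and> a \<le> length la then la ! (a - 1) else 0)"

definition nodes :: "nat list \<Rightarrow> (nat \<times> nat) set" where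
  "nodes la = {(a, b). 1 \<le> a \<and> a \<le> length la \<and> 1 \<le> b \<and> b \<le> part la a}"

(* Elements of Z/eZ are represented by the integers in {0..<int e} throughout. *)
definition residue :: "nat \<Rightarrow> nat \<times> nat \<Rightarrow> int" where
  "residue e = (\<lambda>(a, b). (int b - int a) mod int e)"

definition residue_count :: "nat \<Rightarrow> nat list \<Rightarrow> int \<Rightarrow> nat" where
  "residue_count e la i = card {n \<in> nodes la. residue e n = i}"

(* The free abelian group Q is the set of finitely supported integer-valued functions
   with keys in {0..<int e}; the basis element alpha_i is frag_of i. *)
definition root_lattice :: "nat \<Rightarrow> (int \<Rightarrow>\<^sub>0 int) set" where
  "root_lattice e = {c. Poly_Mapping.keys c \<subseteq> {0..<int e}}"

definition content :: "nat \<Rightarrow> nat list \<Rightarrow> (int \<Rightarrow>\<^sub>0 int)" where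
  "content e la = (\<Sum>i\<in>{0..<int e}. frag_cmul (int (residue_count e la i)) (frag_of i))"

definition contents :: "nat \<Rightarrow> (int \<Rightarrow>\<^sub>0 int) set" where
  "contents e = {content e la | la. is_partition la}"

lemma content_in_root_lattice: "content e la \<in> root_lattice e"
  unfolding content_def root_lattice_def
  by (auto dest!: subsetD[OF Poly_Mapping.keys_sum] split: if_splits)

(* The integer division is exact, see two_times_weight. *)
definition weight :: "nat \<Rightarrow> (int \<Rightarrow>\<^sub>0 int) \<Rightarrow> int" where
  "weight e c = Poly_Mapping.lookup c 0 -
     (\<Sum>i\<in>{0..<int e}.
        (Poly_Mapping.lookup c i - Poly_Mapping.lookup c ((i + 1) mod int e))\<^sup>2) div 2"

definition shift_lattice :: "nat \<Rightarrow> nat \<Rightarrow> (int \<Rightarrow>\<^sub>0 int) \<Rightarrow> (int \<Rightarrow>\<^sub>0 int)" where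
  "shift_lattice e e' = frag_extend (\<lambda>i. frag_of ((i - int e') mod int e))"

section \<open>Beta-sets, abacus runners and the shift of partitions\<close>

definition beta_set :: "nat list \<Rightarrow> int set" where
  "beta_set la = {int (part la a) - int a | a. 1 \<le> a}"

definition runner :: "nat \<Rightarrow> nat list \<Rightarrow> int \<Rightarrow> int set" where
  "runner e la i = {j. i + j * int e \<in> beta_set la}"

(* The description is proper for every e > 0, see ex1_shift_partition. *)
definition shift_partition :: "nat \<Rightarrow> nat \<Rightarrow> nat list \<Rightarrow> nat list" where
  "shift_partition e e' la = (THE mu. is_partition mu \<and>
     (\<forall>i\<in>{0..<int e}. runner e mu i = runner e la ((i + int e') mod int e)))"

section \<open>Exactness of the division in the weight\<close>

lemma bij_betw_add_mod:
  fixes e :: nat and k :: int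
  assumes "0 < e"
  shows "bij_betw (\<lambda>i. (i + k) mod int e) {0..<int e} {0..<int e}"
proof (rule bij_betw_byWitness[where f' = "\<lambda>i. (i - k) mod int e"])
  show "\<forall>i\<in>{0..<int e}. ((i + k) mod int e - k) mod int e = i"
    by (simp add: mod_diff_left_eq)
  show "\<forall>i\<in>{0..<int e}. ((i - k) mod int e + k) mod int e = i"
    by (simp add: mod_add_left_eq)
qed (use assms in auto)

lemma two_times_weight:
  assumes "0 < e"
  shows "2 * weight e c = 2 * Poly_Mapping.lookup c 0 -
     (\<Sum>i\<in>{0..<int e}.
        (Poly_Mapping.lookup c i - Poly_Mapping.lookup c ((i + 1) mod int e))\<^sup>2)"
proof -
  define f where "f = Poly_Mapping.lookup c"
  define d where "d = (\<lambda>i. f i - f ((i + 1) mod int e))"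
  have "(\<Sum>i\<in>{0..<int e}. f ((i + 1) mod int e)) = (\<Sum>i\<in>{0..<int e}. f i)"
    using sum.reindex_bij_betw[OF bij_betw_add_mod[OF assms, of 1], of f] .
  then have d0: "(\<Sum>i\<in>{0..<int e}. d i) = 0"
    by (simp add: d_def sum_subtractf)
  have "(\<Sum>i\<in>{0..<int e}. (d i)\<^sup>2) = (\<Sum>i\<in>{0..<int e}. (d i)\<^sup>2 - d i)"
    using d0 by (simp add: sum_subtractf)
  moreover have "even (\<Sum>i\<in>{0..<int e}. (d i)\<^sup>2 - d i)"
    by (rule dvd_sum) simp
  ultimately have "even (\<Sum>i\<in>{0..<int e}. (d i)\<^sup>2)"
    by simp
  then show ?thesis
    unfolding weight_def d_def f_def by (simp add: algebra_simps)
qed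

section \<open>Existence and uniqueness of the shifted partition\<close>

lemma part_antimono:
  assumes "is_partition la" "1 \<le> a" "a \<le> b"
  shows "part la b \<le> part la a"
proof (cases "a = b \<or> b > length la")
  case True
  then show ?thesis by (auto simp: part_def)
next
  case False
  then have "la ! (a - 1) \<ge> la ! (b - 1)"
    using assms unfolding is_partition_def
    by (intro sorted_wrt_nth_less[of "(\<ge>)"]) auto
  then show ?thesis using False assms by (auto simp: part_def)
qed

lemma beta_strict:
  assumes "is_partition la" "1 \<le> a" "a < b"
  shows "int (part la b) - int b < int (part la a) - int a"
  using part_antimono[OF assms(1,2), of b] assms(3) by simp

lemma beta_set_part_le:
  assumes la: "is_partition la" and mu: "is_partition mu" and eq: "beta_set la = beta_set mu"
    and a: "1 \<le> a" and IH: "\<And>b. 1 \<le> b \<Longrightarrow> b < a \<Longrightarrow> part la b = part mu b"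
  shows "part la a \<le> part mu a"
proof -
  have "int (part la a) - int a \<in> beta_set mu"
    using eq a by (auto simp: beta_set_def)
  then obtain c where c: "1 \<le> c" "int (part la a) - int a = int (part mu c) - int c"
    by (auto simp: beta_set_def)
  have "\<not> c < a"
    using beta_strict[OF la, of c a] IH[of c] c by auto
  then show ?thesis
    using part_antimono[OF mu a, of c] c by simp
qed

lemma inj_beta_set:
  assumes la: "is_partition la" and mu: "is_partition mu" and eq: "beta_set la = beta_set mu"
  shows "la = mu"
proof -
  have pe: "part la a = part mu a" if "1 \<le> a" for a
    using that
  proof (induction a rule: less_induct)
    case (less a)
    then show ?case
      using beta_set_part_le[OF la mu eq, of a] beta_set_part_le[OF mu la eq[symmetric], of a]
      by (metis le_antisym)
  qed
  have pos: "a \<le> length nu \<longleftrightarrow> 0 < part nu a" if "is_partition nu" "1 \<le> a" for nu a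
    using that by (auto simp: part_def is_partition_def)
  have "a \<le> length la \<longleftrightarrow> a \<le> length mu" if "1 \<le> a" for a
    using pos[OF la that] pos[OF mu that] pe[OF that] by simp
  then have len: "length la = length mu"
    by (metis le_antisym le_refl linorder_le_cases not_less_eq_eq One_nat_def le_0_eq)
  show ?thesis
  proof (rule nth_equalityI[OF len])
    fix i assume "i < length la"
    then show "la ! i = mu ! i"
      using pe[of "Suc i"] len by (simp add: part_def)
  qed
qed

lemma beta_set_card:
  assumes la: "is_partition la" and N: "length la \<le> N" "part la 1 \<le> N"
  shows "card (beta_set la \<inter> {- int N..<int N}) = N"
    and "x < - int N \<Longrightarrow> x \<in> beta_set la"
    and "x \<in> beta_set la \<Longrightarrow> x < int N"
proof -
  let ?f = "\<lambda>a. int (part la a) - int a"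
  have up: "?f a < int N" if "1 \<le> a" for a
    using part_antimono[OF la, of 1 a] that N by simp
  have "beta_set la \<inter> {- int N..<int N} = ?f ` {1..N}"
  proof (intro equalityI subsetI)
    fix x assume "x \<in> beta_set la \<inter> {- int N..<int N}"
    then obtain a where a: "1 \<le> a" "x = ?f a" "- int N \<le> x"
      by (auto simp: beta_set_def)
    have "a \<le> N"
    proof (rule ccontr)
      assume "\<not> a \<le> N"
      then show False using a N by (simp add: part_def)
    qed
    then show "x \<in> ?f ` {1..N}" using a by auto
  next
    fix x assume "x \<in> ?f ` {1..N}"
    then show "x \<in> beta_set la \<inter> {- int N..<int N}"
      using up by (fastforce simp: beta_set_def)
  qed
  moreover have "inj_on ?f {1..N}"
    by (rule inj_onI) (metis beta_strict[OF la] atLeastAtMost_iff less_irrefl linorder_neqE_nat)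
  ultimately show "card (beta_set la \<inter> {- int N..<int N}) = N"
    by (simp add: card_image)
  show "x \<in> beta_set la" if "x < - int N"
  proof -
    have "x = ?f (nat (- x))" "1 \<le> nat (- x)"
      using that N by (auto simp: part_def)
    then show ?thesis unfolding beta_set_def by blast
  qed
  show "x < int N" if "x \<in> beta_set la"
    using that up by (auto simp: beta_set_def)
qed

lemma ex_partition_beta_set:
  assumes card: "card (B \<inter> {- int N..<int N}) = N"
    and lo: "\<And>x. x < - int N \<Longrightarrow> x \<in> B"
    and hi: "\<And>x. x \<in> B \<Longrightarrow> x < int N"
  shows "\<exists>mu. is_partition mu \<and> beta_set mu = B"
proof -
  define F where "F = B \<inter> {- int N..<int N}"
  define xs where "xs = rev (sorted_list_of_set F)"
  have fin: "finite F" by (simp add: F_def)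
  have len: "length xs = N" using card by (simp add: xs_def F_def)
  have set: "set xs = F" using fin by (simp add: xs_def)
  have dec: "sorted_wrt (>) xs"
    unfolding xs_def sorted_wrt_rev by simp
  have gap: "xs ! (i + k) + int k \<le> xs ! i" if "i + k < N" for i k
    using that
  proof (induction k)
    case (Suc k)
    then have "xs ! (i + Suc k) < xs ! (i + k)"
      using dec len by (intro sorted_wrt_nth_less[OF dec]) auto
    then show ?case using Suc by simp
  qed simp
  have nonneg: "0 \<le> xs ! i + int i + 1" if "i < N" for i
  proof -
    have "xs ! (N - 1) \<in> F" using set len that by (metis nth_mem diff_less less_imp_Suc_add zero_less_Suc zero_less_one)
    then have "- int N \<le> xs ! (N - 1)" by (simp add: F_def)
    moreover have "xs ! (N - 1) + int (N - 1 - i) \<le> xs ! i"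
      using gap[of i "N - 1 - i"] that by simp
    ultimately show ?thesis using that by simp
  qed
  define ys where "ys = map (\<lambda>i. nat (xs ! i + int i + 1)) [0..<N]"
  define mu where "mu = takeWhile (\<lambda>y. 0 < y) ys"
  have sorted: "sorted_wrt (\<ge>) ys"
    unfolding sorted_wrt_iff_nth_less
  proof (intro allI impI)
    fix i j assume ij: "i < j" "j < length ys"
    then have "xs ! j + int (j - i) \<le> xs ! i"
      using gap[of i "j - i"] by (simp add: ys_def)
    then show "ys ! j \<le> ys ! i" using ij by (simp add: ys_def nat_le_eq_zle)
  qed
  have "sorted_wrt (\<ge>) mu"
    using sorted unfolding mu_def
    by (metis sorted_wrt_append takeWhile_dropWhile_id)
  then have mu: "is_partition mu"
    unfolding is_partition_def mu_def by (auto dest: set_takeWhileD)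
  have part_mu: "part mu a = part ys a" for a
  proof (cases "1 \<le> a \<and> length mu < a \<and> a \<le> length ys")
    case True
    then have "length mu < length ys" by simp
    then have "\<not> 0 < ys ! length mu"
      unfolding mu_def by (rule nth_length_takeWhile)
    moreover have "ys ! (a - 1) \<le> ys ! length mu"
    proof (cases "length mu = a - 1")
      case False
      then show ?thesis
        using True by (intro sorted_wrt_nth_less[OF sorted]) auto
    qed simp
    ultimately show ?thesis using True by (simp add: part_def)
  next
    case False
    have "length mu \<le> length ys"
      by (simp add: mu_def length_takeWhile_le)
    then show ?thesis
      using False by (auto simp: part_def mu_def takeWhile_nth)
  qed
  have val: "int (part mu a) - int a = (if a \<le> N then xs ! (a - 1) else - int a)" if "1 \<le> a" for a
  proof -
    have "part mu a = (if a \<le> N then nat (xs ! (a - 1) + int (a - 1) + 1) else 0)"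
      unfolding part_mu using that by (auto simp: part_def ys_def)
    then show ?thesis using nonneg[of "a - 1"] that by auto
  qed
  have "beta_set mu = B"
  proof (intro equalityI subsetI)
    fix x assume "x \<in> beta_set mu"
    then obtain a where a: "1 \<le> a" "x = int (part mu a) - int a"
      by (auto simp: beta_set_def)
    show "x \<in> B"
    proof (cases "a \<le> N")
      case True
      then have "x = xs ! (a - 1)" using a val by simp
      moreover have "xs ! (a - 1) \<in> set xs" using a True len by (intro nth_mem) simp
      ultimately show ?thesis unfolding set F_def by simp
    next
      case False
      then show ?thesis using a val lo by simp
    qed
  next
    fix x assume x: "x \<in> B"
    have "\<exists>a. x = int (part mu a) - int a \<and> 1 \<le> a"
    proof (cases "x < - int N")
      case True
      then show ?thesis using val[of "nat (- x)"] by (intro exI[of _ "nat (- x)"]) auto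
    next
      case False
      then have "x \<in> set xs" using x hi unfolding set F_def by simp
      then obtain i where "i < N" "x = xs ! i" by (metis in_set_conv_nth len)
      then show ?thesis using val[of "Suc i"] by (intro exI[of _ "Suc i"]) auto
    qed
    then show "x \<in> beta_set mu" unfolding beta_set_def by blast
  qed
  then show ?thesis using mu by blast
qed

lemma runner_eq_iff:
  assumes e: "0 < e"
  shows "(\<forall>i\<in>{0..<int e}. runner e mu i = runner e la ((i + k) mod int e)) \<longleftrightarrow>
    beta_set mu = {x. (x mod int e + k) mod int e + (x div int e) * int e \<in> beta_set la}"
    (is "?L \<longleftrightarrow> beta_set mu = ?B")
proof
  assume L: ?L
  have "x \<in> beta_set mu \<longleftrightarrow> x \<in> ?B" for x
  proof -
    have "x mod int e \<in> {0..<int e}" using e by simp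
    then have "runner e mu (x mod int e) = runner e la ((x mod int e + k) mod int e)"
      using L by blast
    then have "x div int e \<in> runner e mu (x mod int e) \<longleftrightarrow>
        x div int e \<in> runner e la ((x mod int e + k) mod int e)"
      by simp
    then show ?thesis by (simp add: runner_def mult.commute)
  qed
  then show "beta_set mu = ?B" by blast
next
  assume "beta_set mu = ?B"
  then show ?L by (auto simp: runner_def)
qed

lemma ex1_shift_partition:
  assumes la: "is_partition la" and e: "0 < e"
  shows "\<exists>!mu. is_partition mu \<and>
    (\<forall>i\<in>{0..<int e}. runner e mu i = runner e la ((i + int k) mod int e))"
proof -
  define g where "g = (\<lambda>k x. (x mod int e + k) mod int e + (x div int e) * int e)"
  define B where "B = {x. g (int k) x \<in> beta_set la}"
  define M where "M = length la + part la 1"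
  define N where "N = e * M"
  have N: "length la \<le> N" "part la 1 \<le> N"
    using e by (auto simp: N_def M_def intro: order_trans[of _ M])
  have gdiv: "g l x div int e = x div int e" and gmod: "g l x mod int e = (x + l) mod int e" for l x
    using e by (simp_all add: g_def mod_add_left_eq)
  have ginv: "g (- l) (g l x) = x" for l x
  proof -
    have "g (- l) (g l x) = ((x + l) mod int e - l) mod int e + (x div int e) * int e"
      using gdiv[of l x] gmod[of l x] by (simp add: g_def)
    then show ?thesis by (simp add: mod_diff_left_eq)
  qed
  have less: "x < int e * m \<longleftrightarrow> x div int e < m" for x m
  proof
    assume "x < int e * m"
    then have "int e * (x div int e) < int e * m"
      using mult_div_mod_eq[of "int e" x] pos_mod_sign[of "int e" x] e by linarith
    then show "x div int e < m"
      using e by simp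
  next
    assume "x div int e < m"
    then have "int e * (x div int e + 1) \<le> int e * m"
      using e by (intro mult_left_mono) auto
    moreover have "x < int e * (x div int e + 1)"
      unfolding distrib_left
      using e mult_div_mod_eq[of "int e" x] pos_mod_bound[of "int e" x] by linarith
    ultimately show "x < int e * m" by simp
  qed
  have g_lo: "g l x < - int N \<longleftrightarrow> x < - int N" for l x
    using less[of "g l x" "- int M"] less[of x "- int M"] by (simp add: gdiv N_def)
  have g_hi: "g l x < int N \<longleftrightarrow> x < int N" for l x
    using less[of "g l x" "int M"] less[of x "int M"] by (simp add: gdiv N_def)
  let ?I = "{- int N..<int N}"
  have gI: "g l x \<in> ?I \<longleftrightarrow> x \<in> ?I" for l x
    using g_lo[of l x] g_hi[of l x] by auto
  have "bij_betw (g (int k)) (B \<inter> ?I) (beta_set la \<inter> ?I)"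
  proof (rule bij_betw_byWitness[where f' = "g (- int k)"])
    have ginv': "g (int k) (g (- int k) x) = x" for x using ginv[of "- int k" x] by simp
    show "\<forall>x\<in>B \<inter> ?I. g (- int k) (g (int k) x) = x" by (simp add: ginv)
    show "\<forall>x\<in>beta_set la \<inter> ?I. g (int k) (g (- int k) x) = x" by (simp add: ginv')
    show "g (int k) ` (B \<inter> ?I) \<subseteq> beta_set la \<inter> ?I" using gI by (auto simp: B_def)
    show "g (- int k) ` (beta_set la \<inter> ?I) \<subseteq> B \<inter> ?I" using gI by (auto simp: B_def ginv')
  qed
  then have card: "card (B \<inter> ?I) = N"
    using bij_betw_same_card beta_set_card(1)[OF la N] by metis
  have "\<exists>mu. is_partition mu \<and> beta_set mu = B"
  proof (rule ex_partition_beta_set[OF card])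
    show "x \<in> B" if "x < - int N" for x
      using beta_set_card(2)[OF la N] that by (simp add: B_def g_lo)
    show "x < int N" if "x \<in> B" for x
      using beta_set_card(3)[OF la N, of "g (int k) x"] that by (simp add: B_def g_hi)
  qed
  moreover have "(\<forall>i\<in>{0..<int e}. runner e mu i = runner e la ((i + int k) mod int e)) \<longleftrightarrow>
      beta_set mu = B" for mu
    using runner_eq_iff[OF e] by (simp add: B_def g_def)
  ultimately show ?thesis
    using inj_beta_set by metis
qed

end

theory Submission
  imports Defs
begin

text \<open>Each runner of the abacus of \<open>\<lambda>\<close> has two invariants: its charge \<open>x\<^sub>i\<close>, the surplus of beads over
  the abacus of the empty partition, and its excess \<open>w\<^sub>i \<ge> 0\<close>, the number of steps by which its beads
  have been raised above their lowest possible positions. The content of \<open>\<lambda>\<close> knows these only as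
  follows: \<open>c\<^sub>i - c\<^sub>i\<^sub>+\<^sub>1 = x\<^sub>i\<close> (\<open>residue_count_diff_eq_charge\<close>), and the weight is the sum of all \<open>w\<^sub>i\<close>
  (\<open>weight_content_eq_sum_excess\<close>). Conversely the charges and the weight determine the content
  (\<open>content_eq_if_charges_weight_eq\<close>). Both identities come from one formula, which writes
  \<open>c\<^sub>i\<close> as a sum of \<open>(b - i) div e\<close> over the beads \<open>b\<close>, compared with the same sum for the
  empty partition (\<open>residue_count_beta_set\<close>).

  A partition is fixed by the shift iff its runners are periodic with period \<open>e'\<close>. Then the charges
  are periodic, hence so is the content, and the excesses are periodic, so that their sum over the
  \<open>e = p e'\<close> runners is a multiple of \<open>p\<close>.

  For the converse, take the charges of any partition with content \<open>\<alpha>\<close>; they are periodic because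
  \<open>\<alpha>\<close> is. The weight of \<open>\<alpha>\<close> is \<open>p w\<close> with \<open>w \<ge> 0\<close>, being divisible by \<open>p\<close> and a sum of excesses.
  Runners may be prescribed freely as long as their charges sum to \<open>0\<close>
  (\<open>ex_partition_charge_excess\<close>), so there is a partition with the given charges whose excess is \<open>w\<close> on
  the \<open>p\<close> runners \<open>i\<close> with \<open>e'\<close> dividing \<open>i\<close> and \<open>0\<close> on the others. Its runners are periodic, and it
  has the charges and the weight of \<open>\<alpha>\<close>, hence the content \<open>\<alpha>\<close>.\<close>

section \<open>Counting nodes by residue from the beta-set\<close>

lemma div_diff_succ:
  fixes e :: int
  assumes "0 < e"
  shows "(z + 1) div e - z div e = (if e dvd z + 1 then 1 else 0)"
proof (cases "e dvd z + 1")
  case True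
  then obtain k where k: "z + 1 = e * k" by (auto elim: dvdE)
  then have "z = e * (k - 1) + (e - 1)" by (simp add: algebra_simps)
  then have "z div e = k - 1"
    using assms by (intro int_div_pos_eq[of _ _ _ "e - 1"]) auto
  then show ?thesis using True k assms by simp
next
  case False
  then have "(z + 1) mod e \<noteq> 0" by (simp add: dvd_eq_mod_eq_0)
  moreover have "0 \<le> (z + 1) mod e" "(z + 1) mod e < e" using assms by simp_all
  moreover have "z = e * ((z + 1) div e) + ((z + 1) mod e - 1)"
    using mult_div_mod_eq[of e "z + 1"] by linarith
  ultimately have "z div e = (z + 1) div e"
    by (intro int_div_pos_eq[where r = "(z + 1) mod e - 1"]) linarith+
  then show ?thesis using False by simp
qed

lemma dvd_diff_iff_mod_eq:
  fixes e :: int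
  assumes "i \<in> {0..<e}"
  shows "e dvd v - i \<longleftrightarrow> v mod e = i"
  using assms by (simp add: mod_eq_dvd_iff[symmetric])

lemma card_residue_interval:
  fixes e :: int
  assumes "0 < e" "i \<in> {0..<e}" "x \<le> y"
  shows "int (card {v \<in> {x<..y}. v mod e = i}) = (y - i) div e - (x - i) div e"
  using assms(3)
proof (induction y rule: int_ge_induct)
  case base
  then show ?case by simp
next
  case (step y)
  define S where "S = {v \<in> {x<..y}. v mod e = i}"
  have S: "finite S" "y + 1 \<notin> S"
    unfolding S_def by (rule finite_subset[of _ "{x<..y}"]) auto
  have split: "{v \<in> {x<..y + 1}. v mod e = i} = (if (y + 1) mod e = i then insert (y + 1) S else S)"
    using step.hyps by (auto simp: S_def order_le_less)
  have "(y + 1 - i) div e - (y - i) div e = (if (y + 1) mod e = i then 1 else 0)"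
    using div_diff_succ[OF assms(1), of "y - i"] dvd_diff_iff_mod_eq[OF assms(2), of "y + 1"]
    by (simp add: algebra_simps)
  then show ?case
    using step.IH S unfolding split S_def[symmetric] by (simp split: if_split_asm)
qed

text \<open>In row \<open>a\<close> the values \<open>b - a\<close> of the nodes fill the interval from \<open>- a\<close> (excluded) to the
  element \<open>\<lambda>\<^sub>a - a\<close> of the beta-set (included). Empty rows contribute \<open>0\<close>, so any number of
  them may be added.\<close>

lemma residue_count_rows:
  assumes e: "0 < e" and i: "i \<in> {0..<int e}" and N: "length la \<le> N"
  shows "int (residue_count e la i) =
    (\<Sum>a\<in>{1..N}. (int (part la a) - int a - i) div int e - (- int a - i) div int e)"
proof -
  let ?row = "\<lambda>a. {b \<in> {1..part la a}. (int b - int a) mod int e = i}"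
  have row: "int (card (?row a)) = (int (part la a) - int a - i) div int e - (- int a - i) div int e"
    for a
  proof -
    have "bij_betw (\<lambda>b. int b - int a) (?row a)
        {v \<in> {- int a<..int (part la a) - int a}. v mod int e = i}"
      by (rule bij_betw_byWitness[where f' = "\<lambda>v. nat (v + int a)"]) auto
    then have "card (?row a) = card {v \<in> {- int a<..int (part la a) - int a}. v mod int e = i}"
      by (rule bij_betw_same_card)
    then show ?thesis
      using card_residue_interval[of "int e" i "- int a" "int (part la a) - int a"] e i by simp
  qed
  have "{n \<in> nodes la. residue e n = i} = Sigma {1..N} ?row"
    using N by (auto simp: nodes_def residue_def part_def split: if_splits)
  then have "residue_count e la i = (\<Sum>a\<in>{1..N}. card (?row a))"
    unfolding residue_count_def by (simp add: card_SigmaI)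
  then have "int (residue_count e la i) = (\<Sum>a\<in>{1..N}. int (card (?row a)))"
    by (simp only: of_nat_sum)
  then show ?thesis by (simp only: row)
qed

lemma beta_set_window:
  assumes la: "is_partition la" and N: "length la \<le> N" "part la 1 \<le> N"
  shows "bij_betw (\<lambda>a. int (part la a) - int a) {1..N} (beta_set la \<inter> {- int N..<int N})"
proof -
  let ?f = "\<lambda>a. int (part la a) - int a"
  have inj: "inj_on ?f {1..N}"
    by (rule inj_onI) (metis beta_strict[OF la] atLeastAtMost_iff less_irrefl linorder_neqE_nat)
  have "?f ` {1..N} = beta_set la \<inter> {- int N..<int N}"
  proof (rule card_subset_eq)
    show "?f ` {1..N} \<subseteq> beta_set la \<inter> {- int N..<int N}"
    proof
      fix x assume "x \<in> ?f ` {1..N}"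
      then obtain a where a: "1 \<le> a" "a \<le> N" "x = ?f a" by auto
      then have "x \<in> beta_set la" by (auto simp: beta_set_def)
      then show "x \<in> beta_set la \<inter> {- int N..<int N}"
        using beta_set_card(3)[OF la N] a by simp
    qed
    show "card (?f ` {1..N}) = card (beta_set la \<inter> {- int N..<int N})"
      using beta_set_card(1)[OF la N] card_image[OF inj] by simp
  qed simp
  then show ?thesis using inj by (simp add: bij_betw_def)
qed

text \<open>The sum over the rows separates into a sum over the beta-set of \<open>\<lambda>\<close> and one over the
  beta-set \<open>{..<0}\<close> of the empty partition, so that the order of the beads does not matter any
  more and beads may be collected runner by runner. Cutting both sets off at \<open>- N\<close> makes the two
  sums finite.\<close>

lemma residue_count_beta_set:
  assumes e: "0 < e" and i: "i \<in> {0..<int e}"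
    and la: "is_partition la" and N: "length la \<le> N" "part la 1 \<le> N"
  shows "int (residue_count e la i) =
    (\<Sum>b\<in>beta_set la \<inter> {- int N..<int N}. (b - i) div int e) -
    (\<Sum>b\<in>{- int N..<0}. (b - i) div int e)"
proof -
  have "(\<Sum>b\<in>beta_set la \<inter> {- int N..<int N}. (b - i) div int e) =
      (\<Sum>a\<in>{1..N}. (int (part la a) - int a - i) div int e)"
    using sum.reindex_bij_betw[OF beta_set_window[OF la N], of "\<lambda>b. (b - i) div int e"] by simp
  moreover have "(\<Sum>b\<in>{- int N..<0}. (b - i) div int e) =
      (\<Sum>a\<in>{1..N}. (- int a - i) div int e)"
    by (rule sum.reindex_bij_witness[where i = "\<lambda>a. - int a" and j = "\<lambda>b. nat (- b)"]) auto
  ultimately show ?thesis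
    using residue_count_rows[OF e i N(1)] by (simp add: sum_subtractf)
qed

section \<open>Charge and excess of the runners\<close>

text \<open>The charge of a set of beads that agrees with the negative integers up to finitely many
  elements is the number of its non-negative elements minus the number of negative integers that
  it misses. The definition gives this value for every \<open>M\<close> such that the set contains every integer
  below \<open>- M\<close> and none from \<open>M\<close> on.\<close>

definition charge :: "nat \<Rightarrow> int set \<Rightarrow> int" where
  "charge M R = int (card (R \<inter> {- int M..<int M})) - int M"

text \<open>The excess is the total distance by which the beads have been moved up from the lowest
  position with the same charge; it is the size of the partition whose beta-set is the
  runner translated to charge \<open>0\<close>. As for the charge, \<open>M\<close> has to be large enough.\<close>

definition excess :: "nat \<Rightarrow> int set \<Rightarrow> int" where
  "excess M R = \<Sum>(R \<inter> {- int M..<int M}) - \<Sum>{- int M..<charge M R}"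

text \<open>The position \<open>b\<close> lies on runner \<open>b mod e\<close> in abacus row \<open>b div e\<close>. With a window whose bounds are multiples
  of \<open>e\<close>, every runner is cut off at the same rows.\<close>

lemma sum_window_runners:
  fixes S :: "int set" and h :: "int \<Rightarrow> 'a::comm_monoid_add"
  assumes e: "0 < e"
  shows "(\<Sum>b\<in>S \<inter> {- int (e * M)..<int (e * M)}. h b) =
    (\<Sum>i\<in>{0..<int e}. \<Sum>j\<in>{j. i + j * int e \<in> S} \<inter> {- int M..<int M}. h (i + j * int e))"
proof -
  have window: "b div int e \<in> {- int M..<int M} \<longleftrightarrow> b \<in> {- int (e * M)..<int (e * M)}" for b
  proof -
    have le: "m \<le> b div int e \<longleftrightarrow> m * int e \<le> b" for m
    proof
      assume "m \<le> b div int e"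
      then have "m * int e \<le> b div int e * int e" using e by simp
      also have "\<dots> \<le> b" using div_mult_mod_eq[of b "int e"] pos_mod_sign[of "int e" b] e by linarith
      finally show "m * int e \<le> b" .
    next
      assume "m * int e \<le> b"
      then have "m * int e div int e \<le> b div int e" using e by (intro zdiv_mono1) auto
      then show "m \<le> b div int e" using e by simp
    qed
    show ?thesis
      using le[of "- int M"] le[of "int M"] by (auto simp: mult.commute not_le[symmetric])
  qed
  have "(\<Sum>b\<in>S \<inter> {- int (e * M)..<int (e * M)}. h b) =
     (\<Sum>(i, j)\<in>Sigma {0..<int e} (\<lambda>i. {j. i + j * int e \<in> S} \<inter> {- int M..<int M}).
        h (i + j * int e))"
  proof (rule sum.reindex_bij_witness
      [where i = "\<lambda>(i, j). i + j * int e" and j = "\<lambda>b. (b mod int e, b div int e)"])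
    fix b assume b: "b \<in> S \<inter> {- int (e * M)..<int (e * M)}"
    then show "(b mod int e, b div int e) \<in>
        Sigma {0..<int e} (\<lambda>i. {j. i + j * int e \<in> S} \<inter> {- int M..<int M})"
      using e window[of b] by auto
  next
    fix q assume q: "q \<in> Sigma {0..<int e} (\<lambda>i. {j. i + j * int e \<in> S} \<inter> {- int M..<int M})"
    obtain i j where ij: "q = (i, j)" by fastforce
    have "(i + j * int e) div int e = j" using q ij by auto
    then show "(case q of (i, j) \<Rightarrow> i + j * int e) \<in> S \<inter> {- int (e * M)..<int (e * M)}"
      using q ij window[of "i + j * int e"] by auto
  qed auto
  also have "\<dots> = (\<Sum>i\<in>{0..<int e}. \<Sum>j\<in>{j. i + j * int e \<in> S} \<inter> {- int M..<int M}.
      h (i + j * int e))"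
    by (subst sum.Sigma) auto
  finally show ?thesis .
qed

lemma runner_negative:
  assumes "i \<in> {0..<int e}"
  shows "{j. i + j * int e \<in> {..<0}} = {..<0}"
proof -
  have "i + j * int e < 0 \<longleftrightarrow> j < 0" for j
  proof
    assume "i + j * int e < 0"
    then have "j * int e < 0" using assms by auto
    then show "j < 0" by (simp add: mult_less_0_iff)
  next
    assume "j < 0"
    then have "j * int e \<le> (- 1) * int e" by (intro mult_right_mono) auto
    then show "i + j * int e < 0" using assms by simp
  qed
  then show ?thesis by auto
qed

lemma sum_vacuum_runners:
  assumes e: "0 < e"
  shows "(\<Sum>b\<in>{- int (e * M)..<0}. h b) =
    (\<Sum>i\<in>{0..<int e}. \<Sum>j\<in>{- int M..<0}. h (i + j * int e))"
proof -
  have cut: "{..<0} \<inter> {- int n..<int n} = {- int n..<0}" for n by auto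
  show ?thesis
    using sum_window_runners[OF e, of h "{..<0}" M] by (simp only: cut runner_negative cong: sum.cong)
qed

lemma sum_beta_set_runners:
  assumes e: "0 < e"
  shows "(\<Sum>b\<in>beta_set la \<inter> {- int (e * M)..<int (e * M)}. h b) =
    (\<Sum>i\<in>{0..<int e}. \<Sum>j\<in>runner e la i \<inter> {- int M..<int M}. h (i + j * int e))"
  using sum_window_runners[OF e, of h "beta_set la" M] by (simp add: runner_def)

lemma le_mult_pos: "0 < (e::nat) \<Longrightarrow> n \<le> M \<Longrightarrow> n \<le> e * M"
  by (metis One_nat_def Suc_leI le_trans mult_le_mono1 nat_mult_1)

text \<open>A beta-set has as many elements in the window as the negative integers do.\<close>

lemma sum_charge:
  assumes e: "0 < e" and la: "is_partition la" and M: "length la \<le> M" "part la 1 \<le> M"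
  shows "(\<Sum>i\<in>{0..<int e}. charge M (runner e la i)) = 0"
proof -
  have "int (e * M) = (\<Sum>b\<in>beta_set la \<inter> {- int (e * M)..<int (e * M)}. 1)"
    using beta_set_card(1)[OF la le_mult_pos[OF e M(1)] le_mult_pos[OF e M(2)]] by simp
  also have "\<dots> = (\<Sum>i\<in>{0..<int e}. int (card (runner e la i \<inter> {- int M..<int M})))"
    unfolding sum_beta_set_runners[OF e] by simp
  finally show ?thesis
    by (simp add: charge_def sum_subtractf)
qed

text \<open>Passing from residue \<open>i\<close> to \<open>i + 1\<close> lowers \<open>(b - i) div e\<close> precisely for the beads \<open>b\<close> on runner
  \<open>i\<close>. In the wrap-around from \<open>e - 1\<close> to \<open>0\<close> every bead also gains \<open>1\<close>, which cancels because
  the beta-set and that of the empty partition have equally many beads in the window.\<close>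

lemma residue_count_diff_eq_charge:
  assumes e: "0 < e" and i: "i \<in> {0..<int e}"
    and la: "is_partition la" and M: "length la \<le> M" "part la 1 \<le> M"
  shows "int (residue_count e la i) - int (residue_count e la ((i + 1) mod int e)) =
    charge M (runner e la i)"
proof -
  define k where "k = (if i + 1 = int e then 1 else 0 :: int)"
  have i': "(i + 1) mod int e \<in> {0..<int e}" using e by simp
  have N: "length la \<le> e * M" "part la 1 \<le> e * M"
    using le_mult_pos[OF e] M by auto
  let ?B = "beta_set la \<inter> {- int (e * M)..<int (e * M)}"
  let ?V = "{- int (e * M)..<0}"
  let ?d = "\<lambda>b. if b mod int e = i then 1 else 0 :: int"
  have diff: "(b - i) div int e - (b - (i + 1) mod int e) div int e = ?d b - k" for b
  proof -
    have "(b - i) div int e - (b - (i + 1)) div int e = ?d b"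
      using div_diff_succ[of "int e" "b - (i + 1)"] dvd_diff_iff_mod_eq[OF i, of b] e
      by (simp add: algebra_simps)
    moreover have "(b - (i + 1)) div int e = (b - (i + 1) mod int e) div int e - k"
    proof (cases "i + 1 = int e")
      case True
      then show ?thesis using e div_mult_self1[of "int e" "b - int e" 1] by (simp add: k_def)
    next
      case False
      then have "(i + 1) mod int e = i + 1" using i by simp
      then show ?thesis using False by (simp add: k_def)
    qed
    ultimately show ?thesis by simp
  qed
  have "int (residue_count e la i) - int (residue_count e la ((i + 1) mod int e)) =
      (\<Sum>b\<in>?B. ?d b - k) - (\<Sum>b\<in>?V. ?d b - k)"
    unfolding residue_count_beta_set[OF e i la N] residue_count_beta_set[OF e i' la N]
      diff[symmetric] by (simp add: sum_subtractf)
  also have "\<dots> = (\<Sum>b\<in>?B. ?d b) - (\<Sum>b\<in>?V. ?d b)"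
    using beta_set_card(1)[OF la N] by (simp add: sum_subtractf)
  also have "(\<Sum>b\<in>?B. ?d b) =
      (\<Sum>i'\<in>{0..<int e}. if i' = i then int (card (runner e la i \<inter> {- int M..<int M})) else 0)"
    unfolding sum_beta_set_runners[OF e] by (intro sum.cong) auto
  also have "\<dots> = int (card (runner e la i \<inter> {- int M..<int M}))"
    using i by simp
  also have "(\<Sum>b\<in>?V. ?d b) = (\<Sum>i'\<in>{0..<int e}. if i' = i then int M else 0)"
    unfolding sum_vacuum_runners[OF e] by (intro sum.cong) auto
  also have "\<dots> = int M"
    using i by simp
  finally show ?thesis by (simp add: charge_def)
qed

text \<open>For \<open>i = 0\<close> the summand \<open>(b - i) div e\<close> is the abacus row of the bead \<open>b\<close>.\<close>

lemma residue_count_zero_runners: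
  assumes e: "0 < e" and la: "is_partition la" and M: "length la \<le> M" "part la 1 \<le> M"
  shows "int (residue_count e la 0) =
    (\<Sum>i\<in>{0..<int e}. \<Sum>(runner e la i \<inter> {- int M..<int M}) - \<Sum>{- int M..<0})"
proof -
  have N: "length la \<le> e * M" "part la 1 \<le> e * M"
    using le_mult_pos[OF e] M by auto
  have "0 \<in> {0..<int e}" using e by simp
  note residue_count_beta_set[OF e this la N]
  also have "(\<Sum>b\<in>beta_set la \<inter> {- int (e * M)..<int (e * M)}. (b - 0) div int e) =
      (\<Sum>i\<in>{0..<int e}. \<Sum>(runner e la i \<inter> {- int M..<int M}))"
    unfolding sum_beta_set_runners[OF e] by (intro sum.cong) auto
  also have "(\<Sum>b\<in>{- int (e * M)..<0}. (b - 0) div int e) =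
      (\<Sum>i\<in>{0..<int e}. \<Sum>{- int M..<0})"
    unfolding sum_vacuum_runners[OF e] by (intro sum.cong) auto
  finally show ?thesis by (simp only: sum_subtractf)
qed

lemma sum_interval_int:
  fixes x :: int
  assumes "l \<le> x"
  shows "2 * \<Sum>{l..<x} = x * (x - 1) - l * (l - 1)"
  using assms
proof (induction x rule: int_ge_induct)
  case (step x)
  have "{l..<x + 1} = insert x {l..<x}" using step.hyps by auto
  then show ?case using step.IH by (simp add: algebra_simps)
qed simp

lemma lookup_content:
  "Poly_Mapping.lookup (content e la) i =
    (if i \<in> {0..<int e} then int (residue_count e la i) else 0)"
proof -
  have "Poly_Mapping.lookup (content e la) i =
      (\<Sum>j\<in>{0..<int e}. if j = i then int (residue_count e la j) else 0)"
    by (simp add: content_def lookup_sum lookup_single when_def if_distrib cong: if_cong)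
  then show ?thesis by simp
qed

text \<open>A runner of charge \<open>x\<close> and excess \<open>0\<close> contributes \<open>x (x - 1) / 2\<close> to the number of nodes of
  residue \<open>0\<close>. The charges sum to \<open>0\<close>, so these contributions add up to half the sum of the
  squared charges, which is what the weight subtracts.\<close>

lemma weight_content_eq_sum_excess:
  assumes e: "0 < e" and la: "is_partition la" and M: "length la \<le> M" "part la 1 \<le> M"
  shows "weight e (content e la) = (\<Sum>i\<in>{0..<int e}. excess M (runner e la i))"
proof -
  let ?R = "runner e la"
  let ?x = "\<lambda>i. charge M (?R i)"
  let ?S = "\<lambda>i. \<Sum>(?R i \<inter> {- int M..<int M})"
  have per_runner: "2 * excess M (?R i) + (?x i)\<^sup>2 = 2 * (?S i - \<Sum>{- int M..<0}) + ?x i" for i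
  proof -
    have "- int M \<le> ?x i" by (simp add: charge_def)
    then have "2 * \<Sum>{- int M..<?x i} = ?x i * (?x i - 1) - (- int M) * (- int M - 1)"
      by (rule sum_interval_int)
    moreover have "2 * \<Sum>{- int M..<0} = 0 * (0 - 1) - (- int M) * (- int M - 1)"
      by (rule sum_interval_int) simp
    ultimately show ?thesis
      by (simp add: excess_def power2_eq_square algebra_simps)
  qed
  have "(\<Sum>i\<in>{0..<int e}. 2 * excess M (?R i) + (?x i)\<^sup>2) =
      (\<Sum>i\<in>{0..<int e}. 2 * (?S i - \<Sum>{- int M..<0}) + ?x i)"
    by (simp only: per_runner)
  then have sums: "2 * (\<Sum>i\<in>{0..<int e}. excess M (?R i)) + (\<Sum>i\<in>{0..<int e}. (?x i)\<^sup>2) =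
      2 * int (residue_count e la 0)"
    using sum_charge[OF e la M] unfolding residue_count_zero_runners[OF e la M]
    by (simp only: sum.distrib sum_distrib_left[symmetric])
  have "Poly_Mapping.lookup (content e la) i -
      Poly_Mapping.lookup (content e la) ((i + 1) mod int e) = ?x i" if "i \<in> {0..<int e}" for i
    using residue_count_diff_eq_charge[OF e that la M] e that by (simp add: lookup_content)
  then have "2 * weight e (content e la) =
      2 * Poly_Mapping.lookup (content e la) 0 - (\<Sum>i\<in>{0..<int e}. (?x i)\<^sup>2)"
    unfolding two_times_weight[OF e] by (simp only: cong: sum.cong)
  then have "2 * weight e (content e la) =
      2 * int (residue_count e la 0) - (\<Sum>i\<in>{0..<int e}. (?x i)\<^sup>2)"
    using e by (simp add: lookup_content)
  then show ?thesis using sums by simp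
qed

lemma sum_ge_consecutive:
  fixes F :: "int set"
  assumes "finite F" "F \<subseteq> {l..}"
  shows "\<Sum>{l..<l + int (card F)} \<le> \<Sum>F"
  using assms
proof (induction "card F" arbitrary: F)
  case 0
  then show ?case by simp
next
  case (Suc n)
  define m where "m = Max F"
  have ne: "F \<noteq> {}" using Suc.hyps by auto
  have m: "m \<in> F" using Suc.prems ne by (simp add: m_def)
  have card: "card (F - {m}) = n" using Suc.hyps(2) m by simp
  have "F \<subseteq> {l..m}" using Suc.prems by (auto simp: m_def)
  then have "card F \<le> card {l..m}" by (intro card_mono) auto
  then have "l + int n \<le> m" using Suc.hyps(2) by auto
  moreover have "\<Sum>{l..<l + int n} \<le> \<Sum>(F - {m})"
    using Suc.hyps(1)[of "F - {m}"] card Suc.prems by auto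
  moreover have "\<Sum>F = m + \<Sum>(F - {m})"
    using sum.remove[OF Suc.prems(1) m] by simp
  moreover have "{l..<l + int (card F)} = insert (l + int n) {l..<l + int n}"
    using Suc.hyps(2)[symmetric] by auto
  ultimately show ?case by simp
qed

text \<open>Among the sets of \<open>m\<close> integers that are at least \<open>- M\<close>, the \<open>m\<close> lowest ones have the smallest
  sum.\<close>

lemma excess_nonneg: "0 \<le> excess M R"
proof -
  have "R \<inter> {- int M..<int M} \<subseteq> {- int M..}" by auto
  then show ?thesis
    using sum_ge_consecutive[of "R \<inter> {- int M..<int M}" "- int M"]
    by (simp add: excess_def charge_def add.commute)
qed

section \<open>Invariance under the shift\<close>

lemma shift_partition_fixed_iff:
  assumes la: "is_partition la" and e: "0 < e"
  shows "shift_partition e k la = la \<longleftrightarrow>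
    (\<forall>i\<in>{0..<int e}. runner e la i = runner e la ((i + int k) mod int e))"
proof -
  note ex1 = ex1_shift_partition[OF la e, of k]
  show ?thesis
  proof
    assume fixed: "shift_partition e k la = la"
    have "\<forall>i\<in>{0..<int e}.
        runner e (shift_partition e k la) i = runner e la ((i + int k) mod int e)"
      unfolding shift_partition_def by (rule conjunct2[OF theI'[OF ex1]])
    then show "\<forall>i\<in>{0..<int e}. runner e la i = runner e la ((i + int k) mod int e)"
      unfolding fixed .
  next
    assume "\<forall>i\<in>{0..<int e}. runner e la i = runner e la ((i + int k) mod int e)"
    then show "shift_partition e k la = la"
      unfolding shift_partition_def using la by (intro the1_equality[OF ex1] conjI)
  qed
qed

lemma lookup_shift_lattice:
  assumes e: "0 < e" and c: "c \<in> root_lattice e" and j: "j \<in> {0..<int e}"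
  shows "Poly_Mapping.lookup (shift_lattice e k c) j =
    Poly_Mapping.lookup c ((j + int k) mod int e)"
proof -
  have inv: "j = (i - int k) mod int e \<longleftrightarrow> i = (j + int k) mod int e" if "i \<in> {0..<int e}" for i
    using that j by (auto simp: mod_add_left_eq mod_diff_left_eq)
  have "Poly_Mapping.lookup (shift_lattice e k c) j =
      (\<Sum>i\<in>Poly_Mapping.keys c. if j = (i - int k) mod int e then Poly_Mapping.lookup c i else 0)"
    unfolding shift_lattice_def frag_extend_def
    by (simp add: lookup_sum lookup_single when_def if_distrib cong: if_cong)
  also have "\<dots> =
      (\<Sum>i\<in>{0..<int e}. if j = (i - int k) mod int e then Poly_Mapping.lookup c i else 0)"
    using c by (intro sum.mono_neutral_left) (auto simp: root_lattice_def in_keys_iff)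
  also have "\<dots> = (\<Sum>i\<in>{0..<int e}. if i = (j + int k) mod int e then Poly_Mapping.lookup c i else 0)"
    using inv by (intro sum.cong) auto
  also have "\<dots> = Poly_Mapping.lookup c ((j + int k) mod int e)"
    using e by simp
  finally show ?thesis .
qed

lemma shift_lattice_content_fixed_iff:
  assumes e: "0 < e"
  shows "shift_lattice e k (content e la) = content e la \<longleftrightarrow>
    (\<forall>i\<in>{0..<int e}. residue_count e la ((i + int k) mod int e) = residue_count e la i)"
proof -
  let ?c = "content e la"
  have in_keys: "i \<in> {0..<int e}" if "i \<in> Poly_Mapping.keys (shift_lattice e k ?c)" for i
  proof -
    have "Poly_Mapping.keys (shift_lattice e k ?c) \<subseteq>
        (\<Union>i\<in>Poly_Mapping.keys ?c. Poly_Mapping.keys (frag_of ((i - int k) mod int e)))"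
      unfolding shift_lattice_def by (rule keys_frag_extend)
    then show ?thesis using that e by auto
  qed
  have outside: "Poly_Mapping.lookup (shift_lattice e k ?c) i = Poly_Mapping.lookup ?c i"
    if "i \<notin> {0..<int e}" for i
  proof -
    have "Poly_Mapping.lookup (shift_lattice e k ?c) i = 0"
      using in_keys[of i] that by (auto simp: in_keys_iff)
    then show ?thesis using that by (simp only: lookup_content if_False)
  qed
  have "shift_lattice e k ?c = ?c \<longleftrightarrow>
      (\<forall>i. Poly_Mapping.lookup (shift_lattice e k ?c) i = Poly_Mapping.lookup ?c i)"
    by (simp only: poly_mapping_eq_iff fun_eq_iff)
  also have "\<dots> \<longleftrightarrow> (\<forall>i\<in>{0..<int e}.
      Poly_Mapping.lookup ?c ((i + int k) mod int e) = Poly_Mapping.lookup ?c i)"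
  proof -
    have "Poly_Mapping.lookup (shift_lattice e k ?c) i =
        Poly_Mapping.lookup ?c ((i + int k) mod int e)" if "i \<in> {0..<int e}" for i
      using lookup_shift_lattice[OF e content_in_root_lattice that] .
    then show ?thesis using outside by (metis (no_types, lifting))
  qed
  also have "\<dots> \<longleftrightarrow>
      (\<forall>i\<in>{0..<int e}. residue_count e la ((i + int k) mod int e) = residue_count e la i)"
    using e by (simp add: lookup_content)
  finally show ?thesis .
qed

lemma mod_add_swap: "((i + k) mod m + l) mod m = ((i + l) mod m + k) mod (m::int)"
  unfolding mod_add_left_eq by (simp add: ac_simps)

text \<open>The defect \<open>f i - f (i + k)\<close> is the same for all \<open>i\<close> because the differences of \<open>f\<close> are
  periodic, and its sum over a full cycle vanishes.\<close>

lemma periodic_if_differences_periodic: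
  fixes f :: "int \<Rightarrow> int"
  assumes e: "0 < e"
    and d: "\<And>i. i \<in> {0..<int e} \<Longrightarrow>
      f i - f ((i + 1) mod int e) = f ((i + k) mod int e) - f (((i + k) mod int e + 1) mod int e)"
    and i: "i \<in> {0..<int e}"
  shows "f ((i + k) mod int e) = f i"
proof -
  define g where "g = (\<lambda>i. f i - f ((i + k) mod int e))"
  have g_succ: "g ((i + 1) mod int e) = g i" if "i \<in> {0..<int e}" for i
    using d[OF that] unfolding g_def mod_add_swap[of i k] by simp
  have const: "g i = g 0" if "i \<in> {0..<int e}" for i
  proof -
    have "0 \<le> i" using that by simp
    then have "i < int e \<longrightarrow> g i = g 0"
    proof (induction i rule: int_ge_induct)
      case (step i)
      show ?case
      proof
        assume "i + 1 < int e"
        then show "g (i + 1) = g 0" using step g_succ[of i] by simp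
      qed
    qed simp
    then show ?thesis using that by simp
  qed
  have "(\<Sum>i\<in>{0..<int e}. f ((i + k) mod int e)) = (\<Sum>i\<in>{0..<int e}. f i)"
    by (rule sum.reindex_bij_betw[OF bij_betw_add_mod[OF e]])
  then have "(\<Sum>i\<in>{0..<int e}. g i) = 0"
    by (simp add: g_def sum_subtractf)
  moreover have "(\<Sum>i\<in>{0..<int e}. g i) = (\<Sum>i\<in>{0..<int e}. g 0)"
    by (intro sum.cong refl const)
  ultimately show ?thesis
    using const[OF i] e by (simp add: g_def)
qed

lemma sum_periodic:
  fixes f :: "int \<Rightarrow> 'a::comm_semiring_1"
  assumes f: "\<And>i. i \<in> {0..<int (p * d)} \<Longrightarrow> f ((i + int d) mod int (p * d)) = f i"
  shows "(\<Sum>i\<in>{0..<int (p * d)}. f i) = of_nat p * (\<Sum>i\<in>{0..<int d}. f i)"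
proof -
  have block: "f (i + int (q * d)) = f i" if "i \<in> {0..<int d}" "q < p" for i q
    using that(2)
  proof (induction q)
    case (Suc q)
    have "(Suc q + 1) * d \<le> p * d" using Suc.prems by (intro mult_le_mono1) simp
    then have "int (q * d) + int d + int d \<le> int (p * d)" by (simp flip: of_nat_add of_nat_mult)
    then have lt: "i + int (q * d) + int d < int (p * d)" using that(1) by simp
    then have "f (i + int (q * d) + int d) = f (i + int (q * d))"
      using f[of "i + int (q * d)"] that(1) by simp
    then show ?case using Suc by (simp add: algebra_simps)
  qed simp
  have "(\<Sum>i\<in>{0..<int (q * d)}. f i) = of_nat q * (\<Sum>i\<in>{0..<int d}. f i)" if "q \<le> p" for q
    using that
  proof (induction q)
    case (Suc q)
    have "int (Suc q * d) = int (q * d) + int d" by simp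
    then have "{0..<int (Suc q * d)} = {0..<int (q * d)} \<union> {int (q * d)..<int (q * d) + int d}"
      by (simp only: ivl_disj_un_two(3) of_nat_0_le_iff le_add_same_cancel1)
    then have "(\<Sum>i\<in>{0..<int (Suc q * d)}. f i) =
        (\<Sum>i\<in>{0..<int (q * d)}. f i) + (\<Sum>i\<in>{int (q * d)..<int (q * d) + int d}. f i)"
      by (simp add: sum.union_disjoint ivl_disj_int)
    also have "(\<Sum>i\<in>{int (q * d)..<int (q * d) + int d}. f i) =
        (\<Sum>i\<in>{0..<int d}. f (i + int (q * d)))"
      by (rule sum.reindex_bij_witness
          [where i = "\<lambda>i. i + int (q * d)" and j = "\<lambda>i. i - int (q * d)"]) auto
    also have "\<dots> = (\<Sum>i\<in>{0..<int d}. f i)"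
      using Suc.prems by (intro sum.cong refl block) auto
    finally show ?case using Suc by (simp add: algebra_simps)
  qed simp
  then show ?thesis by simp
qed

section \<open>Partitions with prescribed charges and excesses\<close>

lemma eq_if_cyclic_differences_eq:
  fixes f g :: "int \<Rightarrow> int"
  assumes d: "\<And>i. i \<in> {0..<int e} \<Longrightarrow>
      f i - f ((i + 1) mod int e) = g i - g ((i + 1) mod int e)"
    and "f 0 = g 0" and i: "i \<in> {0..<int e}"
  shows "f i = g i"
proof -
  have "0 \<le> i" using i by simp
  then have "i < int e \<longrightarrow> f i = g i"
  proof (induction i rule: int_ge_induct)
    case (step i)
    show ?case
    proof
      assume "i + 1 < int e"
      then show "f (i + 1) = g (i + 1)" using step d[of i] by simp
    qed
  qed (simp add: assms(2))
  then show ?thesis using i by simp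
qed

text \<open>The charges are the differences of the residue counts, and given these, the weight
  determines the residue count at \<open>0\<close>.\<close>

lemma content_eq_if_charges_weight_eq:
  assumes e: "0 < e" and la: "is_partition la" and mu: "is_partition mu"
    and M: "length la \<le> M" "part la 1 \<le> M" and L: "length mu \<le> L" "part mu 1 \<le> L"
    and charge: "\<And>i. i \<in> {0..<int e} \<Longrightarrow> charge M (runner e la i) = charge L (runner e mu i)"
    and weight: "weight e (content e la) = weight e (content e mu)"
  shows "content e la = content e mu"
proof -
  let ?f = "Poly_Mapping.lookup (content e la)" and ?g = "Poly_Mapping.lookup (content e mu)"
  have d: "?f i - ?f ((i + 1) mod int e) = ?g i - ?g ((i + 1) mod int e)"
    if i: "i \<in> {0..<int e}" for i
    using residue_count_diff_eq_charge[OF e i la M] residue_count_diff_eq_charge[OF e i mu L]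
      charge[OF i] i e by (simp add: lookup_content)
  have "(\<Sum>i\<in>{0..<int e}. (?f i - ?f ((i + 1) mod int e))\<^sup>2) =
      (\<Sum>i\<in>{0..<int e}. (?g i - ?g ((i + 1) mod int e))\<^sup>2)"
    by (simp only: d cong: sum.cong)
  then have "?f 0 = ?g 0"
    using weight unfolding weight_def by simp
  then have "?f i = ?g i" if "i \<in> {0..<int e}" for i
    using eq_if_cyclic_differences_eq[of e ?f ?g, OF d _ that] by blast
  then have "?f i = ?g i" for i
    by (cases "i \<in> {0..<int e}") (auto simp: lookup_content)
  then show ?thesis by (rule poly_mapping_eqI)
qed

text \<open>The beads fill all positions below \<open>x\<close>, except that the topmost one has been raised by \<open>n\<close> steps.\<close>

definition raised_runner :: "int \<Rightarrow> nat \<Rightarrow> int set" where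
  "raised_runner x n = insert (x - 1 + int n) {..<x - 1}"

lemma
  assumes M: "- int M < x" "x + int n \<le> int M"
  shows charge_raised_runner: "charge M (raised_runner x n) = x"
    and excess_raised_runner: "excess M (raised_runner x n) = int n"
proof -
  have F: "raised_runner x n \<inter> {- int M..<int M} = insert (x - 1 + int n) {- int M..<x - 1}"
    using M by (auto simp: raised_runner_def)
  show *: "charge M (raised_runner x n) = x"
    using M by (simp add: charge_def F)
  have "{- int M..<x} = insert (x - 1) {- int M..<x - 1}" using M by auto
  then show "excess M (raised_runner x n) = int n"
    unfolding excess_def * F by simp
qed

lemma ex_bound_charge_excess:
  fixes x :: "int \<Rightarrow> int" and n :: "int \<Rightarrow> nat"
  assumes "finite A"
  shows "\<exists>M. \<forall>i\<in>A. \<bar>x i\<bar> + int (n i) < int M"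
proof -
  obtain M where "\<forall>k\<in>(\<lambda>i. nat (\<bar>x i\<bar> + int (n i))) ` A. k < M"
    using finite_imageI[OF assms] finite_nat_set_iff_bounded by blast
  then show ?thesis by (intro exI[of _ M]) force
qed

text \<open>The only obstruction to assembling runners into a beta-set is that the total number of beads
  has to be that of the empty partition.\<close>

lemma ex_partition_charge_excess:
  assumes e: "0 < e" and x: "(\<Sum>i\<in>{0..<int e}. x i) = 0"
  shows "\<exists>la. is_partition la \<and> (\<forall>i\<in>{0..<int e}. runner e la i = raised_runner (x i) (n i))"
proof -
  define B where "B = {v. v div int e \<in> raised_runner (x (v mod int e)) (n (v mod int e))}"
  obtain M where M: "\<And>i. i \<in> {0..<int e} \<Longrightarrow> \<bar>x i\<bar> + int (n i) < int M"
    using ex_bound_charge_excess[of "{0..<int e}" x n] by blast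
  have B_runner: "{j. i + j * int e \<in> B} = raised_runner (x i) (n i)" if "i \<in> {0..<int e}" for i
    using that by (auto simp: B_def)
  have "int (card (B \<inter> {- int (e * M)..<int (e * M)})) =
      (\<Sum>b\<in>B \<inter> {- int (e * M)..<int (e * M)}. 1)"
    by simp
  also have "\<dots> = (\<Sum>i\<in>{0..<int e}. charge M (raised_runner (x i) (n i)) + int M)"
    unfolding sum_window_runners[OF e] by (intro sum.cong) (simp_all add: B_runner charge_def)
  also have "\<dots> = (\<Sum>i\<in>{0..<int e}. x i + int M)"
  proof (rule sum.cong)
    fix i assume "i \<in> {0..<int e}"
    then show "charge M (raised_runner (x i) (n i)) + int M = x i + int M"
      using M[of i] by (subst charge_raised_runner) auto
  qed simp
  also have "\<dots> = int (e * M)"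
    using x by (simp add: sum.distrib)
  finally have card: "card (B \<inter> {- int (e * M)..<int (e * M)}) = e * M"
    by (simp only: of_nat_eq_iff)
  have "\<exists>la. is_partition la \<and> beta_set la = B"
  proof (rule ex_partition_beta_set[OF card])
    fix v :: int
    have i: "v mod int e \<in> {0..<int e}" using e by simp
    have v: "int e * (v div int e) + v mod int e = v" by simp
    show "v \<in> B" if "v < - int (e * M)"
    proof -
      have "int e * (v div int e) < int e * (- int M)"
        using that v i unfolding of_nat_mult mult_minus_right atLeastLessThan_iff by linarith
      then have "v div int e < - int M" using e by (simp only: mult_less_cancel_left_pos of_nat_0_less_iff)
      then have "v div int e < x (v mod int e) - 1" using M[OF i] by linarith
      then show ?thesis by (simp add: B_def raised_runner_def)
    qed
    show "v < int (e * M)" if "v \<in> B"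
    proof -
      have "v div int e + 1 \<le> int M" using that M[OF i] by (auto simp: B_def raised_runner_def)
      then have "int e * (v div int e + 1) \<le> int e * int M" by (intro mult_left_mono) auto
      then show ?thesis
        using v i unfolding of_nat_mult distrib_left atLeastLessThan_iff by linarith
    qed
  qed
  then obtain la where la: "is_partition la" "beta_set la = B" by blast
  then have "runner e la i = raised_runner (x i) (n i)" if "i \<in> {0..<int e}" for i
    using B_runner[OF that] by (simp only: runner_def)
  then show ?thesis using la by blast
qed

theorem theorem4:
  fixes e p e' :: nat and \<alpha> :: "int \<Rightarrow>\<^sub>0 int"
  assumes "2 \<le> e" and "0 < p" and "p dvd e" and "e' = e div p"
    and "\<alpha> \<in> contents e"
  shows "(\<exists>la. is_partition la \<and> content e la = \<alpha> \<and> shift_partition e e' la = la)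
    \<longleftrightarrow> shift_lattice e e' \<alpha> = \<alpha> \<and> int p dvd weight e \<alpha>"
proof -
  have e: "0 < e" and epe: "e = p * e'" using assms by auto
  then have e': "0 < e'" by (cases e') auto
  show ?thesis
  proof
    assume "\<exists>la. is_partition la \<and> content e la = \<alpha> \<and> shift_partition e e' la = la"
    then obtain la where la: "is_partition la" and \<alpha>: "\<alpha> = content e la"
      and fixed: "shift_partition e e' la = la" by blast
    define M where "M = length la + part la 1"
    have M: "length la \<le> M" "part la 1 \<le> M" by (simp_all add: M_def)
    have runner: "runner e la ((i + int e') mod int e) = runner e la i"
      if "i \<in> {0..<int e}" for i
      by (rule bspec[OF fixed[unfolded shift_partition_fixed_iff[OF la e]] that, symmetric])
    have "int (residue_count e la ((i + int e') mod int e)) = int (residue_count e la i)"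
      if "i \<in> {0..<int e}" for i
    proof (rule periodic_if_differences_periodic[OF e _ that])
      fix i assume i: "i \<in> {0..<int e}"
      have i': "(i + int e') mod int e \<in> {0..<int e}" using e by simp
      show "int (residue_count e la i) - int (residue_count e la ((i + 1) mod int e)) =
          int (residue_count e la ((i + int e') mod int e)) -
          int (residue_count e la (((i + int e') mod int e + 1) mod int e))"
        unfolding residue_count_diff_eq_charge[OF e i la M]
          residue_count_diff_eq_charge[OF e i' la M] runner[OF i] ..
    qed
    then have "shift_lattice e e' \<alpha> = \<alpha>"
      unfolding \<alpha> shift_lattice_content_fixed_iff[OF e] by simp
    moreover have "weight e \<alpha> = of_nat p * (\<Sum>i\<in>{0..<int e'}. excess M (runner e la i))"
      unfolding \<alpha> weight_content_eq_sum_excess[OF e la M] unfolding epe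
      by (rule sum_periodic) (simp only: runner flip: epe)
    ultimately show "shift_lattice e e' \<alpha> = \<alpha> \<and> int p dvd weight e \<alpha>" by simp
  next
    assume "shift_lattice e e' \<alpha> = \<alpha> \<and> int p dvd weight e \<alpha>"
    then have fixed: "shift_lattice e e' \<alpha> = \<alpha>" and dvd: "int p dvd weight e \<alpha>" by auto
    obtain mu where mu: "is_partition mu" and \<alpha>: "\<alpha> = content e mu"
      using assms(5) by (auto simp: contents_def)
    define L where "L = length mu + part mu 1"
    have L: "length mu \<le> L" "part mu 1 \<le> L" by (simp_all add: L_def)
    define x where "x = (\<lambda>i. charge L (runner e mu i))"
    have x_periodic: "x ((i + int e') mod int e) = x i" if i: "i \<in> {0..<int e}" for i
    proof -
      let ?c = "residue_count e mu"
      have c: "?c ((i + int e') mod int e) = ?c i" if "i \<in> {0..<int e}" for i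
        by (rule bspec[OF fixed[unfolded \<alpha> shift_lattice_content_fixed_iff[OF e]] that])
      have i': "(i + int e') mod int e \<in> {0..<int e}" "(i + 1) mod int e \<in> {0..<int e}"
        using e by auto
      show ?thesis
        unfolding x_def residue_count_diff_eq_charge[OF e i mu L, symmetric]
          residue_count_diff_eq_charge[OF e i'(1) mu L, symmetric]
          mod_add_swap[of i "int e'"]
        by (simp add: c[OF i] c[OF i'(2)])
    qed
    have "0 \<le> weight e \<alpha>"
      unfolding \<alpha> weight_content_eq_sum_excess[OF e mu L] by (intro sum_nonneg excess_nonneg)
    moreover obtain k where "weight e \<alpha> = int p * k" using dvd by (auto elim: dvdE)
    ultimately have "weight e \<alpha> = int p * int (nat k)"
      using assms(2) by (simp add: zero_le_mult_iff)
    then obtain w where w: "weight e \<alpha> = int p * int w" by blast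
    \<comment> \<open>The shift permutes the runners in \<open>e'\<close> orbits of size \<open>p\<close>. Only the orbit of runner \<open>0\<close>
      receives excess, \<open>w\<close> on each of its members.\<close>
    define n where "n = (\<lambda>i. if i mod int e' = 0 then w else 0)"
    have n_periodic: "n ((i + int e') mod int e) = n i" for i
      using epe by (simp add: n_def mod_mod_cancel)
    obtain la where la: "is_partition la"
      and runner: "\<And>i. i \<in> {0..<int e} \<Longrightarrow> runner e la i = raised_runner (x i) (n i)"
      using ex_partition_charge_excess[OF e, of x n] sum_charge[OF e mu L] by (auto simp: x_def)
    obtain K where K: "\<And>i. i \<in> {0..<int e} \<Longrightarrow> \<bar>x i\<bar> + int (n i) < int K"
      using ex_bound_charge_excess[of "{0..<int e}" x n] by blast
    define M where "M = length la + part la 1 + K"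
    have M: "length la \<le> M" "part la 1 \<le> M" by (simp_all add: M_def)
    have xM: "- int M < x i" "x i + int (n i) \<le> int M" if "i \<in> {0..<int e}" for i
      using K[OF that] by (simp_all add: M_def)
    have "weight e (content e la) = (\<Sum>i\<in>{0..<int e}. int (n i))"
      unfolding weight_content_eq_sum_excess[OF e la M]
      by (intro sum.cong) (simp_all add: runner excess_raised_runner xM)
    also have "\<dots> = of_nat p * (\<Sum>i\<in>{0..<int e'}. int (n i))"
      unfolding epe by (rule sum_periodic) (simp only: n_periodic flip: epe)
    also have "(\<Sum>i\<in>{0..<int e'}. int (n i)) = (\<Sum>i\<in>{0..<int e'}. if i = 0 then int w else 0)"
      by (intro sum.cong) (auto simp: n_def)
    also have "\<dots> = int w" using e' by simp
    finally have "weight e (content e la) = weight e (content e mu)"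
      using w \<alpha> by simp
    then have "content e la = \<alpha>"
      unfolding \<alpha>
      by (intro content_eq_if_charges_weight_eq[OF e la mu M L])
        (simp_all add: runner charge_raised_runner xM, simp add: x_def)
    moreover have "shift_partition e e' la = la"
      unfolding shift_partition_fixed_iff[OF la e]
    proof
      fix i assume i: "i \<in> {0..<int e}"
      have "(i + int e') mod int e \<in> {0..<int e}" using e by simp
      then show "runner e la i = runner e la ((i + int e') mod int e)"
        unfolding runner[OF i] by (simp only: runner x_periodic[OF i] n_periodic)
    qed
    ultimately show "\<exists>la. is_partition la \<and> content e la = \<alpha> \<and> shift_partition e e' la = la"
      using la by blast
  qed
qed

end
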